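(* Let $\mathcal{L}$ be a finite meet-semilattice with minimal element $\hat 0$, and let $\mathcal{G}$ be a building set in $\mathcal{L}$. Then the nested set complex $\mathcal{N}(\mathcal{L},\mathcal{G})$ is homotopy equivalent to the order complex of $\mathcal{L}_{>\hat 0}=\mathcal{L}\setminus\{\hat 0\}$: \[ \mathcal{N}(\mathcal{L},\mathcal{G})\;\simeq\;\Delta(\mathcal{L}_{>\hat 0}). \]
   Context: All posets are finite. A meet-semilattice is a poset in which greatest lower bounds exist for any subset of elements; a finite meet-semilattice $\mathcal{L}$ has a minimal element, denoted $\hat 0$, and $\mathcal{L}_{>\hat 0}:=\mathcal{L}\setminus\{\hat 0\}$. For $X,Y\in\mathcal{L}$, $[X,Y]:=\{Z\in\mathcal{L}\mid X\le Z\le Y\}$. For $\mathcal{S}\subseteq\mathcal{L}$, $\max\mathcal{S}$ is the set of maximal elements of $\mathcal{S}$, and $\mathcal{S}_{\le X}:=\{Y\in\mathcal{S}\mid Y\le X\}$. Joins ($\vee$) are least upper bounds in $\mathcal{L}$, when they exist. Building set: a subset $\mathcal{G}\subseteq\mathcal{L}_{>\hat 0}$ is a building set in $\mathcal{L}$ if for every $X\in\mathcal{L}_{>\hat 0}$, writing $\max\mathcal{G}_{\le X}=\{G_1,\dots,G_k\}$, there is an isomorphism of posets \[ \varphi_X:\ \prod_{j=1}^k[\hat 0,G_j]\ \xrightarrow{\ \cong\ }\ [\hat 0,X] \] with $\varphi_X(\hat 0,\dots,G_j,\dots,\hat 0)=G_j$ for $j=1,\dots,k$ (where $G_j$ stands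 in the $j$-th coordinate). Nested sets: given a building set $\mathcal{G}$ in $\mathcal{L}$, a subset $\mathcal{S}\subseteq\mathcal{G}$ is called nested (or $\mathcal{G}$-nested) if for any set of pairwise incomparable elements $X_1,\dots,X_t$ in $\mathcal{S}$ with $t\ge 2$, the join $X_1\vee\dots\vee X_t$ exists in $\mathcal{L}$ and does not belong to $\mathcal{G}$. The $\mathcal{G}$-nested sets form an abstract simplicial complex $\mathcal{N}(\mathcal{L},\mathcal{G})$ on the vertex set $\mathcal{G}$, the nested set complex. Order complex: for a poset $P$, $\Delta(P)$ is the abstract simplicial complex on the elements of $P$ whose simplices are the linearly ordered subsets of $P$. Homotopy equivalence of abstract simplicial complexes means homotopy equivalence of their geometric realizations. *)

theory Defs
  imports "HOL-Analysis.Analysis" "HOL-Library.Lub_Glb"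
begin

section \<open>Finite meet-semilattices\<close>

text \<open>
  Posets are carrier sets \<open>L\<close> in a type of class \<^class>\<open>order\<close>, with the induced order. Every finite
  poset is isomorphic to such a carrier (e.g. to its principal ideals, ordered by inclusion).
  Meets and joins are taken relative to the carrier, via \<^const>\<open>isGlb\<close> and \<^const>\<open>isLub\<close>.
  The empty set is not required to have a meet: such a meet would be a top element.
\<close>

definition finite_meet_semilattice :: "'a::order set \<Rightarrow> bool" where
  "finite_meet_semilattice L \<longleftrightarrow>
     finite L \<and> L \<noteq> {} \<and> (\<forall>A\<subseteq>L. A \<noteq> {} \<longrightarrow> (\<exists>m. isGlb L A m))"

definition hat0 :: "'a::order set \<Rightarrow> 'a" where
  "hat0 L = (LEAST x. x \<in> L)"

definition interval :: "'a::order set \<Rightarrow> 'a \<Rightarrow> 'a \<Rightarrow> 'a set" where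
  "interval L X Y = {Z \<in> L. X \<le> Z \<and> Z \<le> Y}"

definition maximals :: "'a::order set \<Rightarrow> 'a set" where
  "maximals S = {X \<in> S. \<forall>Y\<in>S. X \<le> Y \<longrightarrow> Y = X}"

definition poset_iso ::
  "'a set \<Rightarrow> ('a \<Rightarrow> 'a \<Rightarrow> bool) \<Rightarrow> 'b set \<Rightarrow> ('b \<Rightarrow> 'b \<Rightarrow> bool) \<Rightarrow> ('a \<Rightarrow> 'b) \<Rightarrow> bool" where
  "poset_iso A le_A B le_B f \<longleftrightarrow>
     bij_betw f A B \<and> (\<forall>x\<in>A. \<forall>y\<in>A. le_A x y \<longleftrightarrow> le_B (f x) (f y))"

section \<open>Building sets and nested sets\<close>

text \<open>
  The product of the intervals below the elements of \<open>M = maximals {Y \<in> \<G>. Y \<le> X}\<close> is indexed by \<open>M\<close>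
  itself: its elements are the functions in \<^const>\<open>PiE\<close>, compared coordinatewise on \<open>M\<close>.
\<close>

definition building_set :: "'a::order set \<Rightarrow> 'a set \<Rightarrow> bool" where
  "building_set L \<G> \<longleftrightarrow> \<G> \<subseteq> L - {hat0 L} \<and>
     (\<forall>X \<in> L - {hat0 L}. let M = maximals {Y \<in> \<G>. Y \<le> X} in
        \<exists>\<phi>. poset_iso
              (\<Pi>\<^sub>E G\<in>M. interval L (hat0 L) G) (\<lambda>p q. \<forall>G\<in>M. p G \<le> q G)
              (interval L (hat0 L) X) (\<le>) \<phi> \<and>
            (\<forall>G\<in>M. \<phi> (\<lambda>H\<in>M. if H = G then G else hat0 L) = G))"

definition nested :: "'a::order set \<Rightarrow> 'a set \<Rightarrow> 'a set \<Rightarrow> bool" where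
  "nested L \<G> S \<longleftrightarrow> S \<subseteq> \<G> \<and>
     (\<forall>A\<subseteq>S. card A \<ge> 2 \<and> pairwise (\<lambda>X Y. \<not> X \<le> Y \<and> \<not> Y \<le> X) A \<longrightarrow>
        (\<exists>J. isLub L A J \<and> J \<notin> \<G>))"

section \<open>Simplicial complexes\<close>

text \<open>
  An abstract simplicial complex is given by its set of simplices, the empty simplex included.
\<close>

definition nested_set_complex :: "'a::order set \<Rightarrow> 'a set \<Rightarrow> 'a set set" where
  "nested_set_complex L \<G> = {S. nested L \<G> S}"

definition order_complex :: "'a::order set \<Rightarrow> 'a set set" where
  "order_complex P = {C. C \<subseteq> P \<and> finite C \<and> Complete_Partial_Order.chain (\<le>) C}"

text \<open>
  Points of the realization are given by barycentric coordinates whose support is a simplex; the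
  empty simplex contributes no point. The topology is that of coordinatewise convergence. For
  complexes with finitely many vertices, the only ones considered here, this is the usual topology
  of the realization as a subspace of a finite-dimensional real vector space.
\<close>

definition geometric_realization :: "'a set set \<Rightarrow> ('a \<Rightarrow> real) topology" where
  "geometric_realization K = subtopology (powertop_real UNIV)
     {x. (\<forall>v. 0 \<le> x v) \<and> {v. x v \<noteq> 0} \<in> K \<and> (\<Sum>v | x v \<noteq> 0. x v) = 1}"

section \<open>Basic facts\<close>

lemma hat0_least:
  assumes "finite_meet_semilattice L"
  shows "hat0 L \<in> L" and "\<And>x. x \<in> L \<Longrightarrow> hat0 L \<le> x"
proof -
  obtain m where m: "isGlb L L m"
    using assms by (auto simp: finite_meet_semilattice_def)
  then have "m \<in> L" "\<And>x. x \<in> L \<Longrightarrow> m \<le> x"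
    by (auto simp: isGlb_def greatestP_def isLb_def setge_def)
  then have "hat0 L = m"
    unfolding hat0_def by (intro Least_equality)
  with \<open>m \<in> L\<close> \<open>\<And>x. x \<in> L \<Longrightarrow> m \<le> x\<close>
  show "hat0 L \<in> L" and "\<And>x. x \<in> L \<Longrightarrow> hat0 L \<le> x" by auto
qed

lemma nested_subset: "nested L \<G> S \<Longrightarrow> T \<subseteq> S \<Longrightarrow> nested L \<G> T"
  unfolding nested_def using subset_trans[of _ T S] subset_trans[of T S \<G>] by simp

lemma nested_singleton:
  assumes "G \<in> \<G>"
  shows "nested L \<G> {G}"
proof -
  have "\<not> card A \<ge> 2" if "A \<subseteq> {G}" for A
    using card_mono[OF _ that] by simp
  then show ?thesis
    using assms unfolding nested_def by force
qed

lemma building_set_all: "building_set L (L - {hat0 L})"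
proof -
  have iso: "\<exists>\<phi>. poset_iso
              (\<Pi>\<^sub>E G\<in>{X}. interval L (hat0 L) G) (\<lambda>p q. \<forall>G\<in>{X}. p G \<le> q G)
              (interval L (hat0 L) X) (\<le>) \<phi> \<and>
            (\<forall>G\<in>{X}. \<phi> (\<lambda>H\<in>{X}. if H = G then G else hat0 L) = G)" for X
  proof (intro exI conjI)
    show "poset_iso (\<Pi>\<^sub>E G\<in>{X}. interval L (hat0 L) G) (\<lambda>p q. \<forall>G\<in>{X}. p G \<le> q G)
            (interval L (hat0 L) X) (\<le>) (\<lambda>p. p X)"
      unfolding poset_iso_def
    proof (intro conjI ballI)
      show "bij_betw (\<lambda>p. p X) (\<Pi>\<^sub>E G\<in>{X}. interval L (hat0 L) G) (interval L (hat0 L) X)"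
        by (rule bij_betw_byWitness[where f' = "\<lambda>y. \<lambda>H\<in>{X}. y"])
          (simp_all add: PiE_def Pi_def extensional_def restrict_def fun_eq_iff image_subset_iff)
    qed simp
  qed auto
  have max: "maximals {Y \<in> L - {hat0 L}. Y \<le> X} = {X}" if "X \<in> L - {hat0 L}" for X
    using that by (auto simp: maximals_def)
  show ?thesis
    unfolding building_set_def Let_def
  proof (intro conjI ballI subset_refl, goal_cases)
    case (1 X)
    show ?case
      unfolding max[OF 1] by (rule iso)
  qed
qed

end

theory Submission
  imports Defs
begin

text \<open>
  Write \<open>F X\<close> (\<open>factors X\<close>) for the set of maximal elements of \<open>\<G>\<close> below \<open>X\<close>. Sending a vertex \<open>X\<close> of the order
  complex to the barycenter of \<open>F X\<close> and extending affinely gives a map from the order complex to the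
  nested set complex: the union of the sets \<open>F X\<close> along a chain is nested. The map is even a
  homeomorphism, exhibiting the order complex as a subdivision of the nested set complex. It is
  inverted by peeling: a nested set \<open>S\<close> has a join \<open>X\<close>, with \<open>F X\<close> the set of maximal elements of
  \<open>S\<close>, so that \<open>X\<close> must be the top of the chain; subtracting the smallest weight that occurs on
  \<open>F X\<close> shrinks the support.
\<close>

section \<open>Joins and meets relative to the carrier\<close>

lemma isLub_iff:
  "isLub L A J \<longleftrightarrow> J \<in> L \<and> (\<forall>a\<in>A. a \<le> J) \<and> (\<forall>U\<in>L. (\<forall>a\<in>A. a \<le> U) \<longrightarrow> J \<le> U)"
  by (auto simp: isLub_def leastP_def isUb_def setle_def setge_def)

lemma isGlb_iff:
  "isGlb L A m \<longleftrightarrow> m \<in> L \<and> (\<forall>a\<in>A. m \<le> a) \<and> (\<forall>U\<in>L. (\<forall>a\<in>A. U \<le> a) \<longrightarrow> U \<le> m)"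
  by (auto simp: isGlb_def greatestP_def isLb_def setle_def setge_def)

lemma isLub_unique_order:
  fixes L :: "'a::order set"
  assumes "isLub L A J" "isLub L A K"
  shows "J = K"
  using assms by (intro order.antisym) (auto simp: isLub_iff)

lemma ex_maximal_above:
  fixes S :: "'a::order set"
  assumes "finite S" "x \<in> S"
  obtains m where "m \<in> maximals S" "x \<le> m"
proof -
  obtain m where "m \<in> S" "x \<le> m" "\<forall>y\<in>S. m \<le> y \<longrightarrow> y = m"
    using finite_has_maximal2[OF assms] by metis
  then show thesis using that by (auto simp: maximals_def)
qed

text \<open>The join is the meet of all upper bounds of \<open>A\<close> in \<open>L\<close>; the
  bound \<open>X\<close> makes that set nonempty, as is required for its meet to exist.\<close>

lemma semilattice_bounded_join:
  assumes L: "finite_meet_semilattice L" and "A \<subseteq> L" "X \<in> L" "\<And>a. a \<in> A \<Longrightarrow> a \<le> X"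
  obtains J where "isLub L A J"
proof -
  let ?U = "{U \<in> L. \<forall>a\<in>A. a \<le> U}"
  have "?U \<subseteq> L" "?U \<noteq> {}" using assms by auto
  then obtain m where "isGlb L ?U m"
    using L unfolding finite_meet_semilattice_def by blast
  then have "isLub L A m"
    using assms(2) by (auto simp: isLub_iff isGlb_iff)
  then show thesis by (rule that)
qed

section \<open>Factors\<close>

locale building_set_in_semilattice =
  fixes L \<G> :: "'a::order set"
  assumes semilattice: "finite_meet_semilattice L"
    and building: "building_set L \<G>"
begin

definition P :: "'a set" where
  "P = L - {hat0 L}"

definition factors :: "'a \<Rightarrow> 'a set" where
  "factors X = maximals {Y \<in> \<G>. Y \<le> X}"

lemma finite_L: "finite L"
  using semilattice by (simp add: finite_meet_semilattice_def)

lemma finite_P: "finite P"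
  using finite_L by (simp add: P_def)

lemma G_subset: "\<G> \<subseteq> P"
  using building by (simp add: building_set_def P_def)

lemma P_subset: "P \<subseteq> L"
  by (auto simp: P_def)

lemma finite_G: "finite \<G>"
  using finite_subset[OF G_subset finite_P] .

lemma factorsD:
  assumes "G \<in> factors X"
  shows "G \<in> \<G>" "G \<le> X" "\<And>H. H \<in> \<G> \<Longrightarrow> H \<le> X \<Longrightarrow> G \<le> H \<Longrightarrow> H = G"
  using assms by (auto simp: factors_def maximals_def)

lemma finite_factors: "finite (factors X)"
  using factorsD(1) by (intro finite_subset[OF _ finite_G]) auto

lemma factors_G:
  assumes "X \<in> \<G>"
  shows "factors X = {X}"
  using assms by (auto simp: factors_def maximals_def)

lemma ex_factor_above:
  assumes "G \<in> \<G>" "G \<le> X"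
  obtains H where "H \<in> factors X" "G \<le> H"
  using ex_maximal_above[of "{Y \<in> \<G>. Y \<le> X}" G] assms finite_G
  by (auto simp: factors_def)

text \<open>The tuple that the isomorphism of a building set is required to send to the factor
  \<open>G\<close> of \<open>X\<close>.\<close>

definition unit_at :: "'a \<Rightarrow> 'a \<Rightarrow> 'a \<Rightarrow> 'a" where
  "unit_at X G = (\<lambda>H\<in>factors X. if H = G then G else hat0 L)"

lemma factor_coordinates:
  assumes "X \<in> P"
  obtains \<phi> where
    "bij_betw \<phi> (\<Pi>\<^sub>E G\<in>factors X. interval L (hat0 L) G) (interval L (hat0 L) X)"
    "\<forall>p\<in>(\<Pi>\<^sub>E G\<in>factors X. interval L (hat0 L) G). \<forall>q\<in>(\<Pi>\<^sub>E G\<in>factors X. interval L (hat0 L) G).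
       \<phi> p \<le> \<phi> q \<longleftrightarrow> (\<forall>G\<in>factors X. p G \<le> q G)"
    "\<forall>G\<in>factors X. \<phi> (unit_at X G) = G"
proof -
  obtain \<phi> where
    "poset_iso (\<Pi>\<^sub>E G\<in>factors X. interval L (hat0 L) G) (\<lambda>p q. \<forall>G\<in>factors X. p G \<le> q G)
       (interval L (hat0 L) X) (\<le>) \<phi>"
    "\<forall>G\<in>factors X. \<phi> (unit_at X G) = G"
    using building assms
    unfolding building_set_def Let_def P_def factors_def[symmetric] unit_at_def by blast
  then show thesis
    by (intro that[of \<phi>]) (simp_all add: poset_iso_def)
qed

lemma unit_at_in:
  assumes "G \<in> factors X"
  shows "unit_at X G \<in> (\<Pi>\<^sub>E G\<in>factors X. interval L (hat0 L) G)"
proof -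
  have "factors X \<subseteq> L" using factorsD(1) G_subset P_subset by blast
  then show ?thesis
    using assms hat0_least[OF semilattice] by (auto simp: unit_at_def interval_def)
qed

text \<open>
  If \<open>A \<subseteq> \<G>\<close> has join \<open>X\<close>, then the part of \<open>A\<close> below a factor \<open>H\<close> has join \<open>H\<close>: an element of \<open>A\<close> not
  below \<open>H\<close> has trivial \<open>H\<close>-coordinate, so it cannot help to reach the top in that coordinate.
\<close>

lemma join_splits:
  assumes X: "X \<in> P" and A: "A \<subseteq> \<G>"
    and lub: "\<And>U. U \<in> L \<Longrightarrow> U \<le> X \<Longrightarrow> (\<And>a. a \<in> A \<Longrightarrow> a \<le> U) \<Longrightarrow> U = X"
    and ub: "\<And>a. a \<in> A \<Longrightarrow> a \<le> X"
    and H: "H \<in> factors X" and h: "h \<in> L" "h \<le> H" "\<And>a. a \<in> A \<Longrightarrow> a \<le> H \<Longrightarrow> a \<le> h"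
  shows "h = H"
proof -
  let ?M = "factors X" and ?I = "interval L (hat0 L)"
  let ?Q = "\<Pi>\<^sub>E G\<in>?M. ?I G"
  obtain \<phi> where bij: "bij_betw \<phi> ?Q (?I X)"
    and le: "\<forall>p\<in>?Q. \<forall>q\<in>?Q. \<phi> p \<le> \<phi> q \<longleftrightarrow> (\<forall>G\<in>?M. p G \<le> q G)"
    and un: "\<forall>G\<in>?M. \<phi> (unit_at X G) = G"
    by (rule factor_coordinates[OF X])
  note mono = le[rule_format] and unit = un[rule_format]
  note bot = hat0_least[OF semilattice]
  have coord: "\<exists>p\<in>?Q. \<phi> p = Z" if "Z \<in> L" "Z \<le> X" for Z
  proof -
    have "Z \<in> \<phi> ` ?Q" using bij_betw_imp_surj_on[OF bij] that bot(2) by (simp add: interval_def)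
    then show ?thesis by blast
  qed
  have FL: "G \<in> L" if "G \<in> ?M" for G
    using factorsD(1)[OF that] G_subset P_subset by auto
  have HX: "H \<le> X" using factorsD(2)[OF H] .
  obtain r where r: "r \<in> ?Q" "\<phi> r = h"
    using coord[OF h(1)] h(2) HX by force
  \<comment> \<open>The top tuple, lowered in the single coordinate \<open>H\<close> to that of
    \<open>h\<close>. Its image turns out to bound \<open>A\<close>, hence to be \<open>X\<close>,
    so the coordinate was not lowered at all.\<close>
  define p where "p = (\<lambda>G\<in>?M. if G = H then r H else G)"
  have pQ: "p \<in> ?Q"
    using r(1) H FL bot by (auto simp: p_def interval_def PiE_def Pi_def)
  have "a \<le> \<phi> p" if a: "a \<in> A" for a
  proof -
    have "a \<in> \<G>" using A a by auto
    then obtain G where G: "G \<in> ?M" "a \<le> G"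
      using ex_factor_above ub[OF a] by metis
    have aL: "a \<in> L" using \<open>a \<in> \<G>\<close> G_subset P_subset by auto
    obtain q where q: "q \<in> ?Q" "\<phi> q = a"
      using coord[OF aL ub[OF a]] by blast
    \<comment> \<open>From \<open>a \<le> G\<close>, the tuple of \<open>a\<close> is trivial in
      every coordinate but \<open>G\<close>.\<close>
    have qu: "\<forall>K\<in>?M. q K \<le> unit_at X G K"
      using mono[OF q(1) unit_at_in[OF G(1)]] q(2) unit[OF G(1)] G(2) by simp
    have "q K \<le> p K" if K: "K \<in> ?M" for K
    proof (cases "K = H")
      case False
      have "q K \<le> K" using q(1) K by (auto simp: interval_def PiE_def Pi_def)
      then show ?thesis using False K by (simp add: p_def)
    next
      case True
      show ?thesis
      proof (cases "G = H")
        case True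
        then have "a \<le> h" using h(3) a G by auto
        then have "q H \<le> r H" using mono[OF q(1) r(1)] q r H by auto
        then show ?thesis using \<open>K = H\<close> H by (simp add: p_def)
      next
        case False
        then have "q K \<le> hat0 L" using qu K True by (force simp: unit_at_def)
        moreover have "hat0 L \<le> p K"
          using pQ K by (auto simp: interval_def PiE_def Pi_def)
        ultimately show ?thesis by simp
      qed
    qed
    then show ?thesis using mono[OF q(1) pQ] q(2) by simp
  qed
  moreover have p: "\<phi> p \<in> L" "\<phi> p \<le> X"
    using bij_betw_apply[OF bij pQ] by (auto simp: interval_def)
  ultimately have "\<phi> p = X" using lub by blast
  then have "\<phi> (unit_at X H) \<le> \<phi> p" using unit[OF H] HX by simp
  then have "unit_at X H H \<le> p H"
    using mono[OF unit_at_in[OF H] pQ] H by blast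
  \<comment> \<open>\<open>p\<close> and \<open>r\<close> agree at \<open>H\<close>, and the unit
    tuple is trivial in all other coordinates; this says \<open>H \<le> h\<close>.\<close>
  then have "\<phi> (unit_at X H) \<le> \<phi> r"
    unfolding mono[OF unit_at_in[OF H] r(1)]
    using H r(1) by (auto simp: unit_at_def p_def interval_def PiE_def Pi_def)
  then show ?thesis using unit[OF H] r(2) h(2) by simp
qed

text \<open>The factors have a join \<open>J \<le> X\<close>. Since \<open>G \<le> J\<close>, the
  \<open>G\<close>-coordinate of \<open>J\<close> is at least \<open>G\<close>, the top of its
  interval, so the tuple of \<open>J\<close> dominates that of \<open>X\<close>.\<close>

lemma factors_isLub:
  assumes X: "X \<in> P"
  shows "isLub L (factors X) X"
proof -
  let ?M = "factors X" and ?I = "interval L (hat0 L)"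
  let ?Q = "\<Pi>\<^sub>E G\<in>?M. ?I G"
  obtain \<phi> where bij: "bij_betw \<phi> ?Q (?I X)"
    and le: "\<forall>p\<in>?Q. \<forall>q\<in>?Q. \<phi> p \<le> \<phi> q \<longleftrightarrow> (\<forall>G\<in>?M. p G \<le> q G)"
    and un: "\<forall>G\<in>?M. \<phi> (unit_at X G) = G"
    by (rule factor_coordinates[OF X])
  note mono = le[rule_format] and unit = un[rule_format]
  have XL: "X \<in> L" using X P_subset by auto
  have FL: "?M \<subseteq> L" using factorsD(1) G_subset P_subset by blast
  obtain J where J: "isLub L ?M J"
    using semilattice_bounded_join[OF semilattice FL XL] factorsD(2) by blast
  have GJ: "G \<le> J" if "G \<in> ?M" for G
    using J that by (auto simp: isLub_iff)
  have JX: "J \<in> L" "J \<le> X"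
    using J XL factorsD(2) by (auto simp: isLub_iff)
  have "J \<in> \<phi> ` ?Q" "X \<in> \<phi> ` ?Q"
    using bij_betw_imp_surj_on[OF bij] JX XL hat0_least(2)[OF semilattice]
    by (simp_all add: interval_def)
  then obtain p q where p: "p \<in> ?Q" "\<phi> p = J" and q: "q \<in> ?Q" "\<phi> q = X" by blast
  have "q G \<le> p G" if G: "G \<in> ?M" for G
  proof -
    have "\<phi> (unit_at X G) \<le> \<phi> p" using unit[OF G] p GJ[OF G] by simp
    then have "unit_at X G G \<le> p G" using mono[OF unit_at_in[OF G] p(1)] G by blast
    moreover have "q G \<le> G" using q(1) G by (auto simp: interval_def PiE_def Pi_def)
    ultimately show ?thesis using G by (simp add: unit_at_def)
  qed
  then have "X \<le> J" using mono[OF q(1) p(1)] p q by auto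
  then show ?thesis using J JX by simp
qed

text \<open>Otherwise \<open>X\<close> would be the join of the empty set, which is
  \<open>hat0 L\<close>.\<close>

lemma factors_nonempty:
  assumes "X \<in> P"
  shows "factors X \<noteq> {}"
proof
  assume "factors X = {}"
  then have "X \<le> hat0 L"
    using factors_isLub[OF assms] hat0_least(1)[OF semilattice] by (simp add: isLub_iff)
  then show False
    using assms hat0_least(2)[OF semilattice, of X] by (auto simp: P_def)
qed

section \<open>Chains and nested sets\<close>

text \<open>An antichain \<open>A\<close> in the union lies below the largest chain element
  \<open>X\<close> that is needed to obtain it, so it has a join. Some \<open>b\<close> in
  \<open>A\<close> is a factor of \<open>X\<close>, hence maximal in \<open>\<G>\<close> below
  \<open>X\<close>; a join in \<open>\<G>\<close> would equal \<open>b\<close> and leave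
  \<open>A\<close> with one element.\<close>

lemma nested_Union_factors:
  assumes CP: "C \<subseteq> P" and chain: "Complete_Partial_Order.chain (\<le>) C"
  shows "nested L \<G> (\<Union>(factors ` C))"
  unfolding nested_def
proof (intro conjI allI impI; (elim conjE)?)
  show "\<Union>(factors ` C) \<subseteq> \<G>" using factorsD(1) by blast
  fix A assume A: "A \<subseteq> \<Union>(factors ` C)" and card: "2 \<le> card A"
    and anti: "pairwise (\<lambda>X Y. \<not> X \<le> Y \<and> \<not> Y \<le> X) A"
  have "A \<noteq> {}" "finite A" using card card.infinite by fastforce+
  have AG: "A \<subseteq> \<G>" using A factorsD(1) by blast
  \<comment> \<open>\<open>c a\<close> is a chain element that has \<open>a\<close> as a factor; the
    top of these finitely many choices serves as \<open>X\<close>.\<close>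
  obtain c where c: "\<And>a. a \<in> A \<Longrightarrow> c a \<in> C \<and> a \<in> factors (c a)"
    using A by (metis UN_E subsetD)
  obtain X where X: "X \<in> c ` A" "\<forall>Y\<in>c ` A. X \<le> Y \<longrightarrow> Y = X"
    using finite_has_maximal[of "c ` A"] \<open>A \<noteq> {}\<close> \<open>finite A\<close> by (metis finite_imageI image_is_empty)
  then obtain b where b: "b \<in> A" "X = c b" by blast
  have top: "c a \<le> X" if "a \<in> A" for a
  proof -
    have "c a \<le> X \<or> X \<le> c a" using chainD[OF chain] c[OF that] c[OF b(1)] b(2) by blast
    then show ?thesis using X(2) that by auto
  qed
  then have AX: "a \<le> X" if "a \<in> A" for a
    using factorsD(2) c[OF that] that order_trans by blast
  have XL: "X \<in> L" using b c[OF b(1)] CP P_subset by blast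
  have "A \<subseteq> L" using AG G_subset P_subset by blast
  then obtain J where J: "isLub L A J"
    using semilattice_bounded_join[OF semilattice _ XL AX] by blast
  have "J \<notin> \<G>"
  proof
    assume "J \<in> \<G>"
    moreover have "J \<le> X" "b \<le> J" using J XL AX b by (auto simp: isLub_iff)
    ultimately have "J = b" using factorsD(3)[of b X J] c[OF b(1)] b(2) by blast
    then have "a \<le> b" if "a \<in> A" for a using J that by (auto simp: isLub_iff)
    then have "A \<subseteq> {b}" using anti b(1) by (auto simp: pairwise_def)
    then have "card A \<le> 1" using card_mono[of "{b}" A] by simp
    then show False using card by simp
  qed
  then show "\<exists>J. isLub L A J \<and> J \<notin> \<G>" using J by blast
qed

lemma pairwise_maximals: "pairwise (\<lambda>X Y. \<not> X \<le> Y \<and> \<not> Y \<le> X) (maximals S)"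
  by (auto simp: pairwise_def maximals_def)

text \<open>This identifies the top of the chain from the nested set alone. By
  \<open>join_splits\<close>, the maximal elements of \<open>S\<close> below a factor
  \<open>H\<close> of their join have join \<open>H\<close>. As \<open>H\<close> lies in
  \<open>\<G>\<close>, nestedness leaves room for only one of them, which is then
  \<open>H\<close>.\<close>

lemma nested_join:
  assumes S: "nested L \<G> S" "S \<noteq> {}"
  obtains X where "X \<in> P" "isLub L S X" "factors X = maximals S"
proof -
  let ?A = "maximals S"
  have SG: "S \<subseteq> \<G>" using S by (simp add: nested_def)
  have finS: "finite S" using finite_subset[OF SG finite_G] .
  have AS: "?A \<subseteq> S" by (auto simp: maximals_def)
  have finA: "finite ?A" using finite_subset[OF AS finS] .
  have neA: "?A \<noteq> {}" using S(2) ex_maximal_above[OF finS] by blast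
  have lubS: "isLub L S X" if "isLub L ?A X" for X
  proof -
    have "(\<forall>a\<in>S. a \<le> U) \<longleftrightarrow> (\<forall>a\<in>?A. a \<le> U)" for U
      using AS ex_maximal_above[OF finS] by (metis order_trans subsetD)
    then show ?thesis using that by (simp add: isLub_iff)
  qed
  have joins: "\<exists>J. isLub L B J \<and> J \<notin> \<G>" if "B \<subseteq> ?A" "card B \<ge> 2" for B
    using S(1) that subset_trans[OF that(1) AS] pairwise_subset[OF pairwise_maximals that(1)]
    by (simp add: nested_def)
  show thesis
  proof (cases "card ?A \<ge> 2")
    \<comment> \<open>With a single maximal element nestedness says nothing, but that element lies
      in \<open>\<G>\<close> and is its own only factor.\<close>
    case False
    moreover have "card ?A > 0" using finA neA by (simp add: card_gt_0_iff)
    ultimately have "card ?A = 1" by linarith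
    then obtain X where X: "?A = {X}" by (auto simp: card_1_singleton_iff)
    then have "X \<in> \<G>" using AS SG by auto
    then have XP: "X \<in> P" using G_subset by auto
    then have "isLub L ?A X" using X P_subset by (auto simp: isLub_iff)
    then show thesis using that[OF XP lubS] factors_G[OF \<open>X \<in> \<G>\<close>] X by simp
  next
    case True
    then obtain X where X: "isLub L ?A X" using joins by blast
    have AX: "a \<le> X" if "a \<in> ?A" for a using X that by (auto simp: isLub_iff)
    have AG: "?A \<subseteq> \<G>" using AS SG by auto
    obtain a where a: "a \<in> ?A" using neA by blast
    have "X \<noteq> hat0 L"
      using AX[OF a] a AG G_subset hat0_least[OF semilattice] unfolding P_def
      by (metis DiffE insertCI order.antisym subsetD)
    then have XP: "X \<in> P" using X by (auto simp: isLub_iff P_def)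
    have gen: "h = H"
      if "H \<in> factors X" "h \<in> L" "h \<le> H" "\<And>a. a \<in> ?A \<Longrightarrow> a \<le> H \<Longrightarrow> a \<le> h" for H h
    proof (rule join_splits[OF XP AG _ AX that])
      fix U assume "U \<in> L" "U \<le> X" "\<And>a. a \<in> ?A \<Longrightarrow> a \<le> U"
      then show "U = X" using X by (intro order.antisym) (auto simp: isLub_iff)
    qed
    have low: "{a \<in> ?A. a \<le> H} = {H}" if H: "H \<in> factors X" for H
    proof -
      let ?B = "{a \<in> ?A. a \<le> H}"
      have HP: "H \<in> P" using factorsD(1)[OF H] G_subset by auto
      have "?B \<noteq> {}"
      proof
        assume "?B = {}"
        then have "hat0 L = H"
          using gen[OF H, of "hat0 L"] hat0_least[OF semilattice] HP P_subset by auto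
        then show False using HP by (simp add: P_def)
      qed
      then have pos: "card ?B > 0" using finA by (simp add: card_gt_0_iff)
      have "\<not> card ?B \<ge> 2"
      proof
        assume "card ?B \<ge> 2"
        then obtain J where J: "isLub L ?B J" "J \<notin> \<G>" using joins[of ?B] by auto
        then have "J = H"
          using gen[OF H, of J] HP P_subset by (auto simp: isLub_iff)
        then show False using J(2) factorsD(1)[OF H] by simp
      qed
      with pos have "card ?B = 1" by linarith
      then obtain b where b: "?B = {b}" by (auto simp: card_1_singleton_iff)
      have "b = H"
      proof (rule gen[OF H])
        show "b \<in> L" using b AG G_subset P_subset by blast
        show "b \<le> H" using b by blast
        show "a \<le> b" if "a \<in> ?A" "a \<le> H" for a
        proof -
          have "a \<in> {b}" using that unfolding b[symmetric] by simp
          then show ?thesis by simp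
        qed
      qed
      then show ?thesis using b by simp
    qed
    have "factors X = ?A"
    proof
      show "factors X \<subseteq> ?A" using low by blast
      show "?A \<subseteq> factors X"
      proof
        fix a assume a: "a \<in> ?A"
        then obtain H where H: "H \<in> factors X" "a \<le> H"
          using ex_factor_above AG AX by (metis subsetD)
        have "a \<in> {H}" using a H(2) unfolding low[OF H(1), symmetric] by simp
        then show "a \<in> factors X" using H(1) by simp
      qed
    qed
    then show thesis using that[OF XP lubS[OF X]] by simp
  qed
qed

section \<open>Subdividing nested weights along chains\<close>

text \<open>The linear map that puts the full weight of each \<open>X\<close> on every factor of
  \<open>X\<close>. Leaving it unnormalized allows weights to be subtracted without
  rescaling.\<close>

definition spread :: "('a \<Rightarrow> real) \<Rightarrow> 'a \<Rightarrow> real" where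
  "spread t G = (\<Sum>X | X \<in> P \<and> G \<in> factors X. t X)"

text \<open>Nonnegative weights cannot cancel.\<close>

lemma support_spread:
  assumes nonneg: "\<And>X. 0 \<le> t X" and supp: "{X. t X \<noteq> 0} \<subseteq> P"
  shows "{G. spread t G \<noteq> 0} = \<Union>(factors ` {X. t X \<noteq> 0})"
proof -
  have "spread t G = 0 \<longleftrightarrow> (\<forall>X. X \<in> P \<and> G \<in> factors X \<longrightarrow> t X = 0)" for G
    unfolding spread_def using finite_P nonneg
    by (subst sum_nonneg_eq_0_iff) auto
  then show ?thesis using supp by auto
qed

text \<open>The top of the supporting chain can be read off the image: it is the join of its own
  factors, and the factors of lower chain elements lie below it.\<close>

lemma isLub_support_spread:
  assumes nonneg: "\<And>X. 0 \<le> t X" and supp: "{X. t X \<noteq> 0} \<in> order_complex P" and "t Y \<noteq> 0"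
  obtains X where "t X \<noteq> 0" "isLub L {G. spread t G \<noteq> 0} X"
proof -
  let ?C = "{X. t X \<noteq> 0}"
  have CP: "?C \<subseteq> P" "finite ?C" and chain: "Complete_Partial_Order.chain (\<le>) ?C"
    using supp by (auto simp: order_complex_def)
  obtain X where X: "X \<in> ?C" "\<forall>Y\<in>?C. X \<le> Y \<longrightarrow> Y = X"
    using finite_has_maximal[OF CP(2)] assms(3) by blast
  have top: "Y \<le> X" if "Y \<in> ?C" for Y
    using X(2) chainD[OF chain that X(1)] that by auto
  have XP: "X \<in> P" using X(1) CP(1) by blast
  have "isLub L (\<Union>(factors ` ?C)) X"
    using factors_isLub[OF XP] X(1) top factorsD(2) unfolding isLub_iff
    by (meson UN_E UN_I order_trans)
  then show thesis
    using that X(1) support_spread[of t, OF nonneg CP(1)] by auto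
qed

text \<open>
  After subtracting the common part of two weights their supports are disjoint; but unless both
  vanish, equal images force them to share the top of their supports.
\<close>

lemma spread_inj:
  assumes t: "\<And>X. 0 \<le> t X" "{X. t X \<noteq> 0} \<in> order_complex P"
    and u: "\<And>X. 0 \<le> u X" "{X. u X \<noteq> 0} \<in> order_complex P"
    and eq: "spread t = spread u"
  shows "t = u"
proof (rule ccontr)
  assume ne: "t \<noteq> u"
  define t' where "t' X = t X - min (t X) (u X)" for X
  define u' where "u' X = u X - min (t X) (u X)" for X
  have sub: "B \<in> order_complex P" if "A \<in> order_complex P" "B \<subseteq> A" for A B
    using that unfolding order_complex_def chain_def by (auto intro: finite_subset)
  have nonneg: "0 \<le> t' X" "0 \<le> u' X" for X by (auto simp: t'_def u'_def)
  have "t X \<noteq> 0" if "t' X \<noteq> 0" for X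
    using that u(1)[of X] by (auto simp: t'_def)
  then have suppt: "{X. t' X \<noteq> 0} \<in> order_complex P" by (intro sub[OF t(2)]) auto
  have "u X \<noteq> 0" if "u' X \<noteq> 0" for X
    using that t(1)[of X] by (auto simp: u'_def)
  then have suppu: "{X. u' X \<noteq> 0} \<in> order_complex P" by (intro sub[OF u(2)]) auto
  note supp = suppt suppu
  have eq': "spread t' = spread u'"
  proof
    fix G
    have "spread t' G - spread u' G = spread t G - spread u G"
      unfolding spread_def sum_subtractf[symmetric] by (simp add: t'_def u'_def)
    then show "spread t' G = spread u' G" using eq by simp
  qed
  have suppP: "{X. t' X \<noteq> 0} \<subseteq> P" "{X. u' X \<noteq> 0} \<subseteq> P"
    using supp by (auto simp: order_complex_def)
  obtain Y where "t Y \<noteq> u Y" using ne by auto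
  then have Y: "t' Y \<noteq> 0 \<or> u' Y \<noteq> 0" by (auto simp: t'_def u'_def min_def)
  then have YP: "Y \<in> P" using suppP by auto
  \<comment> \<open>\<open>Y\<close> is known to lie in only one of the two supports, but the images
    agree, so both images, and therefore both supports, are nonempty.\<close>
  have "{G. spread t' G \<noteq> 0} \<noteq> {}"
  proof -
    obtain G where "G \<in> factors Y" using factors_nonempty[OF YP] by blast
    then have "spread t' G \<noteq> 0 \<or> spread u' G \<noteq> 0"
      using Y support_spread[of t', OF nonneg(1) suppP(1)]
        support_spread[of u', OF nonneg(2) suppP(2)] by blast
    then show ?thesis using eq' by auto
  qed
  then have "\<Union>(factors ` {X. t' X \<noteq> 0}) \<noteq> {}" "\<Union>(factors ` {X. u' X \<noteq> 0}) \<noteq> {}"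
    unfolding support_spread[of t', OF nonneg(1) suppP(1), symmetric]
      support_spread[of u', OF nonneg(2) suppP(2), symmetric] eq' by simp_all
  then obtain V W where V: "t' V \<noteq> 0" and W: "u' W \<noteq> 0" by blast
  obtain X where X: "t' X \<noteq> 0" "isLub L {G. spread t' G \<noteq> 0} X"
    using isLub_support_spread[of t', OF nonneg(1) supp(1) V] .
  obtain Z where Z: "u' Z \<noteq> 0" "isLub L {G. spread u' G \<noteq> 0} Z"
    using isLub_support_spread[of u', OF nonneg(2) supp(2) W] .
  have "X = Z" using isLub_unique_order X(2) Z(2) eq' by metis
  \<comment> \<open>At every point at least one of \<open>t'\<close> and \<open>u'\<close>
    vanishes.\<close>
  then show False using X(1) Z(1) by (auto simp: t'_def u'_def min_def split: if_splits)
qed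

text \<open>Peeling, as an induction on the size of the support. The total weight is arbitrary, so
  the induction may end at the zero weight.\<close>

lemma spread_surj:
  assumes "\<And>G. 0 \<le> y G" "nested L \<G> {G. y G \<noteq> 0}"
  shows "\<exists>t. (\<forall>X. 0 \<le> t X) \<and> {X. t X \<noteq> 0} \<in> order_complex P \<and> spread t = y"
  using assms
proof (induction "card {G. y G \<noteq> 0}" arbitrary: y rule: less_induct)
  case less
  let ?S = "{G. y G \<noteq> 0}"
  have SG: "?S \<subseteq> \<G>" using less.prems(2) by (simp add: nested_def)
  have finS: "finite ?S" using finite_subset[OF SG finite_G] .
  show ?case
  proof (cases "?S = {}")
    case True
    then show ?thesis
      by (intro exI[of _ "\<lambda>_. 0"]) (auto simp: spread_def order_complex_def chain_def fun_eq_iff)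
  next
    case False
    then obtain X where X: "X \<in> P" "isLub L ?S X" "factors X = maximals ?S"
      using nested_join[OF less.prems(2)] by blast
    \<comment> \<open>The largest amount that can be removed from all factors of \<open>X\<close> at
      once; the weight at the minimizer \<open>H\<close> drops to zero.\<close>
    define m where "m = Min (y ` factors X)"
    have fin: "finite (y ` factors X)" and ne: "y ` factors X \<noteq> {}"
      using finite_factors factors_nonempty[OF X(1)] by auto
    obtain H where H: "H \<in> factors X" "y H = m"
      using Min_in[OF fin ne] by (auto simp: m_def)
    have m0: "0 \<le> m" using H less.prems(1) by metis
    have mle: "m \<le> y G" if "G \<in> factors X" for G
      using Min_le[OF fin] that by (auto simp: m_def)
    define y' where "y' G = y G - (if G \<in> factors X then m else 0)" for G
    have HS: "H \<in> ?S" using H(1) unfolding X(3) by (auto simp: maximals_def)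
    have sub: "{G. y' G \<noteq> 0} \<subseteq> ?S"
      unfolding y'_def X(3) by (auto simp: maximals_def split: if_splits)
    moreover have "H \<notin> {G. y' G \<noteq> 0}" using H by (simp add: y'_def)
    ultimately have "card {G. y' G \<noteq> 0} < card ?S"
      using HS by (intro psubset_card_mono finS) blast
    moreover have "0 \<le> y' G" for G
      using less.prems(1) mle by (simp add: y'_def)
    ultimately obtain t where t: "\<And>X. 0 \<le> t X" "{X. t X \<noteq> 0} \<in> order_complex P" "spread t = y'"
      using less.hyps[of y'] nested_subset[OF less.prems(2) sub] by auto
    \<comment> \<open>The weight peeled off the factors is returned as weight on
      \<open>X\<close>.\<close>
    define u where "u = t(X := t X + m)"
    have tP: "{X. t X \<noteq> 0} \<subseteq> P" and chain: "Complete_Partial_Order.chain (\<le>) {X. t X \<noteq> 0}"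
      and fint: "finite {X. t X \<noteq> 0}"
      using t(2) by (auto simp: order_complex_def)
    \<comment> \<open>The factors of \<open>Y\<close> lie in \<open>?S\<close>, hence below
      \<open>X\<close>, and \<open>Y\<close> is their join. So adding \<open>X\<close> on top keeps
      the support a chain.\<close>
    have le: "Y \<le> X" if "t Y \<noteq> 0" for Y
    proof -
      have "factors Y \<subseteq> ?S"
        using sub support_spread[of t, OF t(1) tP] t(3) that by auto
      then have "G \<le> X" if "G \<in> factors Y" for G using X(2) that by (auto simp: isLub_iff)
      moreover have "Y \<in> P" using tP that by auto
      ultimately show ?thesis using factors_isLub[of Y] X(1) P_subset by (auto simp: isLub_iff)
    qed
    have suppu: "{X. u X \<noteq> 0} \<subseteq> insert X {X. t X \<noteq> 0}"
      by (auto simp: u_def split: if_splits)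
    have "{X. u X \<noteq> 0} \<in> order_complex P"
      unfolding order_complex_def mem_Collect_eq
    proof (intro conjI)
      show "{X. u X \<noteq> 0} \<subseteq> P" using suppu tP X(1) by auto
      show "finite {X. u X \<noteq> 0}" using suppu fint by (meson finite_insert finite_subset)
      show "Complete_Partial_Order.chain (\<le>) {X. u X \<noteq> 0}"
        using chain le suppu unfolding chain_def by (metis (mono_tags, lifting) insertE mem_Collect_eq order_refl subsetD)
    qed
    moreover have "0 \<le> u Y" for Y using t(1) m0 by (simp add: u_def)
    moreover have "spread u = y"
    proof
      fix G
      let ?Q = "{X. X \<in> P \<and> G \<in> factors X}"
      have "spread u G = (\<Sum>Y\<in>?Q. t Y + (if Y = X then m else 0))"
        unfolding spread_def by (intro sum.cong) (auto simp: u_def)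
      also have "\<dots> = spread t G + (if G \<in> factors X then m else 0)"
        using finite_P X(1) by (simp add: sum.distrib spread_def)
      finally show "spread u G = y G" by (simp add: t(3) y'_def)
    qed
    ultimately show ?thesis by blast
  qed
qed

text \<open>Double counting: each \<open>X\<close> contributes its weight once per factor. This
  dictates the normalization in \<open>subdivision\<close>.\<close>

lemma sum_spread:
  fixes t :: "'a \<Rightarrow> real"
  shows "(\<Sum>G\<in>\<G>. spread t G) = (\<Sum>X\<in>P. card (factors X) * t X)"
proof -
  have "(\<Sum>G\<in>\<G>. spread t G) = (\<Sum>X\<in>P. \<Sum>G | G \<in> \<G> \<and> G \<in> factors X. t X)"
    unfolding spread_def by (intro sum.swap_restrict finite_P finite_G)
  also have "\<dots> = (\<Sum>X\<in>P. card (factors X) * t X)"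
  proof (intro sum.cong refl)
    fix X
    have "{G. G \<in> \<G> \<and> G \<in> factors X} = factors X" using factorsD(1) by auto
    then show "(\<Sum>G | G \<in> \<G> \<and> G \<in> factors X. t X) = card (factors X) * t X" by simp
  qed
  finally show ?thesis .
qed

text \<open>Division by the number of factors sends the vertex \<open>X\<close> to the barycenter of
  its factors and preserves total weight.\<close>

definition subdivision :: "('a \<Rightarrow> real) \<Rightarrow> 'a \<Rightarrow> real" where
  "subdivision x = spread (\<lambda>X. x X / card (factors X))"

end

section \<open>Geometric realizations\<close>

lemma topspace_geometric_realization:
  "topspace (geometric_realization K) =
     {x. (\<forall>v. 0 \<le> x v) \<and> {v. x v \<noteq> 0} \<in> K \<and> (\<Sum>v | x v \<noteq> 0. x v) = 1}"
  by (simp add: geometric_realization_def)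

text \<open>Summing over a fixed finite vertex set makes the last condition linear in
  \<open>x\<close>.\<close>

lemma topspace_geometric_realization_finite:
  assumes "finite V" "K \<subseteq> Pow V"
  shows "topspace (geometric_realization K) =
    {x. (\<forall>v. 0 \<le> x v) \<and> {v. x v \<noteq> 0} \<in> K \<and> (\<Sum>v\<in>V. x v) = 1}"
proof -
  have "(\<Sum>v | x v \<noteq> 0. x v) = (\<Sum>v\<in>V. x v)" if "{v. x v \<noteq> 0} \<in> K" for x :: "'a \<Rightarrow> real"
    using assms that by (intro sum.mono_neutral_left) auto
  then show ?thesis unfolding topspace_geometric_realization by auto
qed

lemma Hausdorff_geometric_realization: "Hausdorff_space (geometric_realization K)"
  unfolding geometric_realization_def
  by (intro Hausdorff_space_subtopology) (simp add: Hausdorff_space_product_topology)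

text \<open>The realization is a finite union of closed faces, hence closed, and it lies in a cube
  that is compact by Tychonoff.\<close>

lemma compact_geometric_realization:
  assumes V: "finite V" "K \<subseteq> Pow V" and down: "\<And>S T. S \<in> K \<Longrightarrow> T \<subseteq> S \<Longrightarrow> T \<in> K"
  shows "compact_space (geometric_realization K)"
proof -
  let ?T = "topspace (geometric_realization K)"
  \<comment> \<open>The closed face of \<open>S\<close>: the support may be smaller than
    \<open>S\<close>, which is why \<open>K\<close> must be closed under subsets.\<close>
  let ?F = "\<lambda>S. {x :: 'a \<Rightarrow> real. (\<forall>v. 0 \<le> x v) \<and> (\<forall>v\<in>-S. x v = 0) \<and> (\<Sum>v\<in>V. x v) = 1}"
  note T = topspace_geometric_realization_finite[OF V]
  have "?T = (\<Union>S\<in>K. ?F S)"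
  proof (intro equalityI subsetI)
    fix x assume "x \<in> (\<Union>S\<in>K. ?F S)"
    then obtain S where S: "S \<in> K" "x \<in> ?F S" by blast
    then have "{v. x v \<noteq> 0} \<subseteq> S" by auto
    then show "x \<in> ?T" using S down unfolding T by auto
  next
    fix x assume "x \<in> ?T"
    then show "x \<in> (\<Union>S\<in>K. ?F S)" unfolding T by (intro UN_I[of "{v. x v \<noteq> 0}"]) auto
  qed
  moreover have "closed (?F S)" for S
  proof -
    have eq: "?F S = (\<Inter>v. {x. 0 \<le> x v}) \<inter> (\<Inter>v\<in>-S. {x. x v = 0}) \<inter> {x. (\<Sum>v\<in>V. x v) = 1}"
      by auto
    show ?thesis unfolding eq
      by (intro closed_Int closed_INT ballI closed_Collect_le closed_Collect_eq continuous_intros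
          continuous_on_product_coordinates)
  qed
  moreover have "finite K"
    using finite_subset[of K "Pow V"] V by auto
  ultimately have "closed ?T" by (simp add: closed_UN)
  then have cl: "closedin (powertop_real UNIV) ?T" by (simp add: euclidean_product_topology)
  have "?T \<subseteq> (\<Pi>\<^sub>E v\<in>UNIV. {0..1})"
  proof
    fix x assume x: "x \<in> ?T"
    have "x v \<le> 1" for v
    proof (cases "v \<in> V")
      case True
      then have "x v \<le> (\<Sum>v\<in>V. x v)" using x V(1) unfolding T by (intro member_le_sum) auto
      then show ?thesis using x unfolding T by simp
    next
      case False
      then have "x v = 0" using x V(2) unfolding T by auto
      then show ?thesis by simp
    qed
    then show "x \<in> (\<Pi>\<^sub>E v\<in>UNIV. {0..1})" using x unfolding T by auto
  qed
  moreover have "compactin (powertop_real UNIV) (\<Pi>\<^sub>E v\<in>UNIV. {0..1})"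
    by (simp add: compactin_PiE)
  ultimately have "compactin (powertop_real UNIV) ?T"
    using closed_compactin cl by blast
  then show ?thesis
    unfolding geometric_realization_def
    by (simp add: compact_space_subtopology)
qed

section \<open>The homeomorphism and the homotopy equivalence\<close>

context building_set_in_semilattice
begin

text \<open>A continuous bijection from a compact space to a Hausdorff space is a homeomorphism, so
  continuity of the peeling inverse need not be examined.\<close>

lemma homeomorphic_map_subdivision:
  "homeomorphic_map (geometric_realization (order_complex P))
     (geometric_realization (nested_set_complex L \<G>)) subdivision"
proof (rule continuous_imp_homeomorphic_map)
  let ?D = "geometric_realization (order_complex P)"
  let ?N = "geometric_realization (nested_set_complex L \<G>)"
  have KD: "order_complex P \<subseteq> Pow P" by (auto simp: order_complex_def)
  have KN: "nested_set_complex L \<G> \<subseteq> Pow \<G>"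
    by (auto simp: nested_set_complex_def nested_def)
  note D = topspace_geometric_realization_finite[OF finite_P KD]
  note N = topspace_geometric_realization_finite[OF finite_G KN]
  have pos: "card (factors X) > 0" if "X \<in> P" for X
    using factors_nonempty[OF that] finite_factors by (simp add: card_gt_0_iff)
  have off: "x X = 0" if "x \<in> topspace ?D" "X \<notin> P" for x X
    using that KD unfolding D by auto
  have scaled: "(\<forall>X. 0 \<le> x X / card (factors X)) \<and>
      {X. x X / card (factors X) \<noteq> 0} = {X. x X \<noteq> 0}" if "x \<in> topspace ?D" for x
  proof -
    have "x X / card (factors X) \<noteq> 0 \<longleftrightarrow> x X \<noteq> 0" for X
      using off[OF that, of X] pos[of X] by (cases "X \<in> P") auto
    then show ?thesis using that unfolding D by auto
  qed
  show "compact_space ?D"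
    by (rule compact_geometric_realization[OF finite_P KD])
      (auto simp: order_complex_def chain_def intro: finite_subset)
  show "Hausdorff_space ?N" by (rule Hausdorff_geometric_realization)
  have into: "subdivision x \<in> topspace ?N" if x: "x \<in> topspace ?D" for x
  proof -
    let ?t = "\<lambda>X. x X / card (factors X)"
    note s = scaled[OF x]
    have C: "{X. x X \<noteq> 0} \<in> order_complex P" using x unfolding D by simp
    have supp: "{G. spread ?t G \<noteq> 0} = \<Union>(factors ` {X. x X \<noteq> 0})"
      using support_spread[of ?t] s KD C by auto
    have "nested L \<G> {G. spread ?t G \<noteq> 0}"
      unfolding supp using C by (intro nested_Union_factors) (auto simp: order_complex_def)
    moreover have "(\<Sum>G\<in>\<G>. spread ?t G) = (\<Sum>X\<in>P. x X)"
      unfolding sum_spread using pos by (intro sum.cong refl) auto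
    moreover have "0 \<le> spread ?t G" for G
      unfolding spread_def using s by (intro sum_nonneg) auto
    ultimately show ?thesis
      using x unfolding N D subdivision_def by (simp add: nested_set_complex_def)
  qed
  \<comment> \<open>Each coordinate of the image is a fixed linear combination of finitely many
    coordinates.\<close>
  have cont: "continuous_on UNIV subdivision"
    unfolding subdivision_def spread_def[abs_def] divide_inverse
    by (intro continuous_on_coordinatewise_then_product continuous_intros
        continuous_on_product_coordinates)
  show "continuous_map ?D ?N subdivision"
    unfolding geometric_realization_def continuous_map_in_subtopology
    using into
    by (auto simp: euclidean_product_topology topspace_geometric_realization
        intro: continuous_on_subset[OF cont])
  show "subdivision ` topspace ?D = topspace ?N"
  proof (intro equalityI subsetI)
    fix y assume y: "y \<in> topspace ?N"
    then obtain t where t: "\<And>X. 0 \<le> t X" "{X. t X \<noteq> 0} \<in> order_complex P" "spread t = y"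
      using spread_surj[of y] unfolding N by (auto simp: nested_set_complex_def)
    \<comment> \<open>This undoes the division in \<open>subdivision\<close>; by
      \<open>sum_spread\<close> the total weight becomes that of \<open>y\<close>, namely 1.\<close>
    define x where "x X = card (factors X) * t X" for X
    have tP: "t X = 0" if "X \<notin> P" for X using KD t(2) that by auto
    have "{X. x X \<noteq> 0} = {X. t X \<noteq> 0}" using tP pos by (auto simp: x_def)
    moreover have "(\<Sum>X\<in>P. x X) = 1"
      using y sum_spread[of t] t(3) unfolding N x_def by simp
    ultimately have "x \<in> topspace ?D" using t unfolding D by (simp add: x_def)
    moreover have "(\<lambda>X. x X / card (factors X)) = t"
      using tP pos by (fastforce simp: x_def fun_eq_iff)
    ultimately show "y \<in> subdivision ` topspace ?D"
      using t(3) by (auto simp: subdivision_def)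
  qed (use into in auto)
  show "inj_on subdivision (topspace ?D)"
  proof
    fix x z assume x: "x \<in> topspace ?D" and z: "z \<in> topspace ?D"
      and eq: "subdivision x = subdivision z"
    have "(\<lambda>X. x X / card (factors X)) = (\<lambda>X. z X / card (factors X))"
      by (rule spread_inj) (use scaled[OF x] scaled[OF z] x z eq in \<open>simp_all add: D subdivision_def\<close>)
    then have xz: "x X / card (factors X) = z X / card (factors X)" for X by (rule fun_cong)
    have "x X = z X" for X
    proof (cases "X \<in> P")
      case True
      then show ?thesis using xz[of X] pos by force
    next
      case False
      then show ?thesis
        using off[OF x False] off[OF z False] by simp
    qed
    then show "x = z" by auto
  qed
qed

end

theorem proposition3p3:
  fixes L \<G> :: "'a::order set"
  assumes "finite_meet_semilattice L"
    and "building_set L \<G>"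
  shows "geometric_realization (nested_set_complex L \<G>) homotopy_equivalent_space
         geometric_realization (order_complex (L - {hat0 L}))"
proof -
  interpret building_set_in_semilattice L \<G>
    using assms by unfold_locales
  show ?thesis
    using homeomorphic_map_subdivision homeomorphic_map_imp_homeomorphic_space
      homeomorphic_space_sym homeomorphic_imp_homotopy_equivalent_space
    unfolding P_def by blast
qed

end
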